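(* Let $\mathcal{P}$ be a player that, for every integer $k>1$, is guaranteed to solve (win) the $k$-hitting game in $f(k)$ rounds in expectation (i.e., against every referee, the expected number of rounds until $\mathcal{P}$ wins is at most $f(k)$). Then $f(k)\in\Omega(\log k)$.
   Context: The $k$-hitting game ($k>1$ an integer) is played between a player and a referee. At the beginning the referee secretly selects a non-empty target set $T\subseteq\{1,\dots,k\}$. The game proceeds in rounds. In each round the player generates a proposal $P\subseteq\{1,\dots,k\}$. If $|P\cap T|=1$ the player wins the game; otherwise it moves on to the next round, learning nothing except that its proposal failed. Both player and referee are probabilistic automata (they may use randomness); the player does not know the definition of the referee, and the referee does not know the player's random bits (so $T$ is chosen independently of the player's randomness). The player's strategy may depend on $k$. Asymptotics are as $k\to\infty$. *)

theory Defs
  imports "HOL-Probability.Probability" "HOL-Library.Landau_Symbols"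
begin

text \<open>
  A player is a probabilistic automaton, presented as a transition function that consumes one
  fresh sample (``random bits'') per round. The samples of different rounds are independent
  draws from \<open>coins\<close>, an arbitrary probability space. Given the current state and the sample,
  \<open>trans\<close> yields the proposal of this round and the state in which the player continues when it
  is told that the proposal has failed. As long as the game lasts, failure is the only answer the
  player ever receives, so there is no further input to the transition function.
\<close>

record ('s, 'r) player =
  start :: 's
  trans :: "'s \<Rightarrow> 'r \<Rightarrow> nat set \<times> 's"
  coins :: "'r measure"

primrec state :: "('s, 'r) player \<Rightarrow> 'r stream \<Rightarrow> nat \<Rightarrow> 's" where
  "state A \<omega> 0 = start A"
| "state A \<omega> (Suc n) = snd (trans A (state A \<omega> n) (\<omega> !! n))"

text \<open>Rounds are indexed from 0 here: \<open>proposal A n\<close> is the proposal made in round \<open>n + 1\<close>.\<close>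

definition proposal :: "('s, 'r) player \<Rightarrow> nat \<Rightarrow> 'r stream \<Rightarrow> nat set" where
  "proposal A n \<omega> = fst (trans A (state A \<omega> n) (\<omega> !! n))"

text \<open>The measurability condition includes that all proposals are subsets of \<open>{1..k}\<close>.\<close>

definition hitting_player :: "nat \<Rightarrow> ('s, 'r) player \<Rightarrow> bool" where
  "hitting_player k A \<longleftrightarrow> prob_space (coins A) \<and>
     (\<forall>n. proposal A n \<in> stream_space (coins A) \<rightarrow>\<^sub>M count_space (Pow {1..k}))"

text \<open>
  The only choice of a referee is the target set at the beginning of the game, so a (probabilistic)
  referee is the distribution of that set.
\<close>

definition hitting_referee :: "nat \<Rightarrow> nat set pmf \<Rightarrow> bool" where
  "hitting_referee k R \<longleftrightarrow> (\<forall>T\<in>set_pmf R. T \<noteq> {} \<and> T \<subseteq> {1..k})"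

text \<open>The number of rounds until the first win, which is \<open>\<infinity>\<close> if the player never wins.\<close>

definition rounds_to_win :: "('s, 'r) player \<Rightarrow> 'r stream \<Rightarrow> nat set \<Rightarrow> ennreal" where
  "rounds_to_win A \<omega> T = (INF n \<in> {n. card (proposal A n \<omega> \<inter> T) = 1}. of_nat (Suc n))"

text \<open>The product measure makes the target independent of the randomness of the player.\<close>

definition expected_rounds :: "('s, 'r) player \<Rightarrow> nat set pmf \<Rightarrow> ennreal" where
  "expected_rounds A R =
     (\<integral>\<^sup>+ (\<omega>, T). rounds_to_win A \<omega> T \<partial>(stream_space (coins A) \<Otimes>\<^sub>M measure_pmf R))"

definition solves_in_expectation :: "nat \<Rightarrow> ('s, 'r) player \<Rightarrow> real \<Rightarrow> bool" where
  "solves_in_expectation k A t \<longleftrightarrow> hitting_player k A \<and>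
     (\<forall>R. hitting_referee k R \<longrightarrow> expected_rounds A R \<le> ennreal t)"

end

theory Submission
  imports Defs
begin

text \<open>
  Average over targets that are dyadic blocks: the scale is uniform among \<open>0..L\<close>, and so is the
  block of that scale inside a block of length \<open>2 ^ L \<le> k\<close>. A fixed proposal \<open>P\<close> meets such a target
  in exactly one point with probability at most \<open>2 / (L + 1)\<close>: the largest blocks that isolate a
  point of \<open>P\<close> are pairwise disjoint, and the scales below such a block contribute a geometric
  series. Hence about \<open>L / 4\<close> rounds fail with probability at least \<open>1 / 2\<close>.
\<close>

text \<open>The sum, over all scales, of the mean of \<open>g\<close> over the dyadic blocks of that scale.\<close>

primrec dyadic_sum :: "nat \<Rightarrow> nat \<Rightarrow> (nat set \<Rightarrow> real) \<Rightarrow> real" where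
  "dyadic_sum 0 a g = g {a<..a + 1}"
| "dyadic_sum (Suc L) a g =
     g {a<..a + 2 ^ Suc L} + (dyadic_sum L a g + dyadic_sum L (a + 2 ^ L) g) / 2"

text \<open>Only dyadic blocks inside the given one are ever evaluated. The two conditions on
  \<open>T\<close> are what makes such a block a legal target set.\<close>

lemma dyadic_sum_mono:
  assumes "\<And>T. T \<noteq> {} \<Longrightarrow> T \<subseteq> {a<..a + 2 ^ L} \<Longrightarrow> g T \<le> h T"
  shows "dyadic_sum L a g \<le> dyadic_sum L a h"
  using assms
proof (induction L arbitrary: a)
  case 0
  then show ?case by simp
next
  case (Suc L)
  have "dyadic_sum L a g \<le> dyadic_sum L a h"
    by (rule Suc.IH, rule Suc.prems) auto
  moreover have "dyadic_sum L (a + 2 ^ L) g \<le> dyadic_sum L (a + 2 ^ L) h"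
    by (rule Suc.IH, rule Suc.prems) auto
  moreover have "g {a<..a + 2 ^ Suc L} \<le> h {a<..a + 2 ^ Suc L}"
    by (rule Suc.prems) auto
  ultimately show ?case by (simp add: add_mono divide_right_mono)
qed

lemma dyadic_sum_const: "dyadic_sum L a (\<lambda>_. c) = (real L + 1) * c"
  by (induction L arbitrary: a) (simp_all add: algebra_simps)

lemma dyadic_sum_add:
  "dyadic_sum L a (\<lambda>T. g T + h T) = dyadic_sum L a g + dyadic_sum L a h"
  by (induction L arbitrary: a) (simp_all add: field_simps)

lemma dyadic_sum_cmult: "dyadic_sum L a (\<lambda>T. c * g T) = c * dyadic_sum L a g"
  by (induction L arbitrary: a) (simp_all add: field_simps)

lemma dyadic_sum_sum:
  "finite I \<Longrightarrow> dyadic_sum L a (\<lambda>T. \<Sum>i\<in>I. g i T) = (\<Sum>i\<in>I. dyadic_sum L a (g i))"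
  by (induction I rule: finite_induct) (simp_all add: dyadic_sum_add dyadic_sum_const)

text \<open>A dyadic sum is a finite linear combination of values.
  \<open>has_bochner_integral\<close> carries integrability and the value of the integral through
  one induction.\<close>

lemma has_bochner_integral_dyadic_sum:
  fixes h :: "'a \<Rightarrow> nat set \<Rightarrow> real"
  assumes "\<And>T. integrable M (\<lambda>x. h x T)"
  shows "has_bochner_integral M (\<lambda>x. dyadic_sum L a (h x)) (dyadic_sum L a (\<lambda>T. \<integral>x. h x T \<partial>M))"
proof (induction L arbitrary: a)
  case 0
  show ?case using assms by (simp add: has_bochner_integral_integrable)
next
  case (Suc L)
  show ?case
    unfolding dyadic_sum.simps
    by (intro has_bochner_integral_add has_bochner_integral_divide_zero Suc.IH)
       (simp_all add: has_bochner_integral_integrable assms)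
qed

lemma dyadic_sum_hits_disjoint:
  "P \<inter> {a<..a + 2 ^ L} = {} \<Longrightarrow> dyadic_sum L a (\<lambda>T. of_bool (card (P \<inter> T) = 1)) = 0"
proof (induction L arbitrary: a)
  case 0
  then show ?case by simp
next
  case (Suc L)
  have "{a<..a + 2 ^ Suc L} = {a<..a + 2 ^ L} \<union> {a + 2 ^ L<..a + 2 ^ L + 2 ^ L}"
    by auto
  then have "P \<inter> {a<..a + 2 ^ L} = {}" "P \<inter> {a + 2 ^ L<..a + 2 ^ L + 2 ^ L} = {}"
    using Suc.prems by blast+
  then show ?case
    using Suc.prems Suc.IH[of a] Suc.IH[of "a + 2 ^ L"] by simp
qed

text \<open>The bound 2 is the fixed point of \<open>c = 1 + c / 2\<close>. If the whole block
  isolates a point of \<open>P\<close>, it contributes 1, but one of its halves misses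
  \<open>P\<close> and contributes 0; otherwise the block contributes 0 and the mean over its halves
  is at most 2.\<close>

lemma dyadic_sum_hits_le: "dyadic_sum L a (\<lambda>T. of_bool (card (P \<inter> T) = 1)) \<le> 2"
proof (induction L arbitrary: a)
  case 0
  show ?case by simp
next
  case (Suc L)
  let ?h = "\<lambda>T. of_bool (card (P \<inter> T) = 1)"
  let ?B = "{a<..a + 2 ^ L}" and ?C = "{a + 2 ^ L<..a + 2 ^ L + 2 ^ L}"
  show ?case
  proof (cases "card (P \<inter> {a<..a + 2 ^ Suc L}) = 1")
    case True
    then obtain x where x: "P \<inter> {a<..a + 2 ^ Suc L} = {x}"
      by (rule card_1_singletonE)
    have "P \<inter> ?B \<subseteq> {x} \<inter> ?B" "P \<inter> ?C \<subseteq> {x} \<inter> ?C"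
      unfolding x[symmetric] by auto
    moreover have "{x} \<inter> ?B = {} \<or> {x} \<inter> ?C = {}" by auto
    ultimately have "P \<inter> ?B = {} \<or> P \<inter> ?C = {}"
      by (metis subset_empty)
    then have "dyadic_sum L a ?h = 0 \<or> dyadic_sum L (a + 2 ^ L) ?h = 0"
      using dyadic_sum_hits_disjoint by blast
    then show ?thesis
      using True Suc.IH[of a] Suc.IH[of "a + 2 ^ L"] by (elim disjE) simp_all
  next
    case False
    then show ?thesis
      using Suc.IH[of a] Suc.IH[of "a + 2 ^ L"] by simp
  qed
qed

text \<open>Exchanging the sum over blocks with the expectation over the coins reduces a random
  proposal to the pointwise bound for a fixed one.\<close>

lemma dyadic_sum_prob_hit_le:
  assumes "prob_space M" and [measurable]: "Q \<in> M \<rightarrow>\<^sub>M count_space X"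
  shows "dyadic_sum L a (\<lambda>T. measure M {\<omega> \<in> space M. card (Q \<omega> \<inter> T) = 1}) \<le> 2"
proof -
  interpret prob_space M by fact
  define h where "h \<omega> T = indicat_real {\<omega> \<in> space M. card (Q \<omega> \<inter> T) = 1} \<omega>" for \<omega> T
  have meas: "{\<omega> \<in> space M. card (Q \<omega> \<inter> T) = 1} \<in> sets M" for T
    by measurable
  have int: "integrable M (\<lambda>\<omega>. h \<omega> T)" for T
    unfolding h_def using meas by (intro integrable_real_indicator) (auto simp: emeasure_eq_measure)
  have eq: "(\<integral>\<omega>. h \<omega> T \<partial>M) = measure M {\<omega> \<in> space M. card (Q \<omega> \<inter> T) = 1}" for T
    unfolding h_def by (simp add: Int_absorb1 Collect_mono_iff subset_eq)
  have "has_bochner_integral M (\<lambda>\<omega>. dyadic_sum L a (h \<omega>))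
      (dyadic_sum L a (\<lambda>T. measure M {\<omega> \<in> space M. card (Q \<omega> \<inter> T) = 1}))"
    using has_bochner_integral_dyadic_sum[of M h L a, OF int] unfolding eq .
  then have i: "integrable M (\<lambda>\<omega>. dyadic_sum L a (h \<omega>))"
    and e: "(\<integral>\<omega>. dyadic_sum L a (h \<omega>) \<partial>M) =
      dyadic_sum L a (\<lambda>T. measure M {\<omega> \<in> space M. card (Q \<omega> \<inter> T) = 1})"
    by (auto simp: has_bochner_integral_iff)
  have "dyadic_sum L a (h \<omega>) \<le> 2" if "\<omega> \<in> space M" for \<omega>
  proof -
    have "h \<omega> = (\<lambda>T. of_bool (card (Q \<omega> \<inter> T) = 1))"
      using that by (auto simp: h_def fun_eq_iff)
    then show ?thesis using dyadic_sum_hits_le[of L a "Q \<omega>"] by simp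
  qed
  then have "(\<integral>\<omega>. dyadic_sum L a (h \<omega>) \<partial>M) \<le> (\<integral>\<omega>. 2 \<partial>M)"
    by (intro integral_mono[OF i]) auto
  then show ?thesis using e by (simp add: prob_space)
qed

lemma rounds_to_win_ge:
  assumes "\<And>m. m < n \<Longrightarrow> card (proposal A m \<omega> \<inter> T) \<noteq> 1"
  shows "of_nat n \<le> rounds_to_win A \<omega> T"
  unfolding rounds_to_win_def
proof (rule INF_greatest)
  fix m assume "m \<in> {m. card (proposal A m \<omega> \<inter> T) = 1}"
  \<comment> \<open>Index \<open>m\<close> stands for \<open>Suc m\<close> rounds, so a first win at
    index \<open>n\<close> or later costs more than \<open>n\<close> rounds. If there is no win, the
    infimum is over the empty set, hence infinite.\<close>
  then have "n \<le> Suc m" using assms[of m] by (cases "m < n") auto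
  then show "(of_nat n :: ennreal) \<le> of_nat (Suc m)" by (simp only: of_nat_le_iff)
qed

text \<open>By the union bound, which allows dependent rounds, the first \<open>n\<close> proposals
  all fail with at least the probability in parentheses; on that event the game lasts at least
  \<open>n\<close> rounds.\<close>

lemma expected_rounds_return_ge:
  assumes "hitting_player k A"
  defines "M \<equiv> stream_space (coins A)"
  shows "ennreal (real n * (1 - (\<Sum>m<n. measure M {\<omega> \<in> space M. card (proposal A m \<omega> \<inter> T) = 1})))
    \<le> expected_rounds A (return_pmf T)"
proof -
  interpret coins: prob_space "coins A"
    using assms by (simp add: hitting_player_def)
  interpret prob_space M
    unfolding M_def by (rule coins.prob_space_stream_space)
  have [measurable]: "proposal A m \<in> M \<rightarrow>\<^sub>M count_space (Pow {1..k})" for m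
    using assms by (simp add: hitting_player_def)
  define H where "H m = {\<omega> \<in> space M. card (proposal A m \<omega> \<inter> T) = 1}" for m
  define E where "E = space M - (\<Union>m<n. H m)"
  have H: "H m \<in> sets M" for m unfolding H_def by measurable
  then have E: "E \<in> sets M" unfolding E_def by auto
  have "measure M (\<Union>m<n. H m) \<le> (\<Sum>m<n. measure M (H m))"
    using H by (intro finite_measure_subadditive_finite) auto
  moreover have "measure M E = 1 - measure M (\<Union>m<n. H m)"
    unfolding E_def using H by (intro prob_compl) auto
  ultimately have "real n * (1 - (\<Sum>m<n. measure M (H m))) \<le> real n * measure M E"
    by (intro mult_left_mono) auto
  then have "ennreal (real n * (1 - (\<Sum>m<n. measure M (H m)))) \<le> of_nat n * emeasure M E"
    by (simp add: emeasure_eq_measure ennreal_of_nat_eq_real_of_nat ennreal_leI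
        flip: ennreal_mult)
  \<comment> \<open>The referee chooses \<open>T\<close> with probability 1, so passing to the
    product space keeps the measure of \<open>E\<close>.\<close>
  also have "\<dots> = of_nat n * emeasure (M \<Otimes>\<^sub>M measure_pmf (return_pmf T)) (E \<times> {T})"
    using E by (subst measure_pmf.emeasure_pair_measure_Times) (auto simp: emeasure_pmf_single)
  also have "\<dots> = (\<integral>\<^sup>+ x. of_nat n * indicator (E \<times> {T}) x \<partial>(M \<Otimes>\<^sub>M measure_pmf (return_pmf T)))"
    using E by (intro nn_integral_cmult_indicator[symmetric] pair_measureI) auto
  also have "\<dots> \<le> expected_rounds A (return_pmf T)"
    unfolding expected_rounds_def M_def[symmetric]
  proof (rule nn_integral_mono)
    fix x
    show "of_nat n * indicator (E \<times> {T}) x \<le> (case x of (\<omega>, T) \<Rightarrow> rounds_to_win A \<omega> T)"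
      by (cases x) (auto simp: E_def H_def indicator_def intro!: rounds_to_win_ge)
  qed
  finally show ?thesis unfolding H_def .
qed

text \<open>Averaging argument in the style of Yao: the bounds against the fixed targets are summed
  over the dyadic blocks, whose total weight is \<open>L + 1\<close>. Each of the \<open>n\<close>
  rounds then costs at most 2 in hitting probability. \<open>max 0 t\<close> appears because
  \<open>ennreal\<close> truncates negative reals to 0.\<close>

lemma solves_in_expectation_lower_bound:
  assumes "solves_in_expectation k A t" and "2 ^ L \<le> k"
  shows "real n * (real L + 1) - 2 * (real n)\<^sup>2 \<le> (real L + 1) * max 0 t"
proof -
  define M where "M = stream_space (coins A)"
  define p where "p m T = measure M {\<omega> \<in> space M. card (proposal A m \<omega> \<inter> T) = 1}" for m T
  have A: "hitting_player k A"
    and le: "\<And>R. hitting_referee k R \<Longrightarrow> expected_rounds A R \<le> ennreal t"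
    using assms by (auto simp: solves_in_expectation_def)
  have M: "prob_space M"
    using A by (auto simp: M_def hitting_player_def intro: prob_space.prob_space_stream_space)
  \<comment> \<open>The left side is written as a constant plus a multiple of a sum, the shape to
    which linearity of \<open>dyadic_sum\<close> applies.\<close>
  have "real n + (- real n) * (\<Sum>m<n. p m T) \<le> max 0 t"
    if "T \<noteq> {}" "T \<subseteq> {0<..0 + 2 ^ L}" for T
  proof -
    have "T \<subseteq> {1..k}" using that(2) assms(2) by fastforce
    with that(1) have "hitting_referee k (return_pmf T)"
      by (simp add: hitting_referee_def)
    from expected_rounds_return_ge[OF A, of n T] le[OF this]
    have "ennreal (real n * (1 - (\<Sum>m<n. p m T))) \<le> ennreal (max 0 t)"
      unfolding p_def M_def ennreal_max_0 by (rule order_trans)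
    then have "real n * (1 - (\<Sum>m<n. p m T)) \<le> max 0 t"
      by (simp only: ennreal_le_iff max.cobounded1)
    then show ?thesis by (simp add: algebra_simps)
  qed
  then have "dyadic_sum L 0 (\<lambda>T. real n + (- real n) * (\<Sum>m<n. p m T))
      \<le> dyadic_sum L 0 (\<lambda>_. max 0 t)"
    by (rule dyadic_sum_mono)
  then have "real n * (real L + 1) - real n * (\<Sum>m<n. dyadic_sum L 0 (p m))
      \<le> (real L + 1) * max 0 t"
    unfolding dyadic_sum_add dyadic_sum_cmult dyadic_sum_const by (simp add: dyadic_sum_sum mult.commute)
  moreover have "(\<Sum>m<n. dyadic_sum L 0 (p m)) \<le> (\<Sum>m<n. 2)"
    unfolding p_def using A
    by (intro sum_mono dyadic_sum_prob_hit_le[OF M]) (auto simp: hitting_player_def M_def)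
  then have "real n * (\<Sum>m<n. dyadic_sum L 0 (p m)) \<le> real n * (2 * real n)"
    by (intro mult_left_mono) (auto simp: mult.commute)
  ultimately show ?thesis by (simp add: power2_eq_square)
qed

theorem theorem3p2:
  fixes A :: "nat \<Rightarrow> ('s, 'r) player" and f :: "nat \<Rightarrow> real"
  assumes "\<And>k. k > 1 \<Longrightarrow> solves_in_expectation k (A k) (f k)"
  shows "f \<in> \<Omega>(\<lambda>k. log 2 (real k))"
proof (rule landau_omega.bigI[of "1 / 16"])
  \<comment> \<open>The estimates below give \<open>f k\<close> at least
    \<open>(log 2 k - 3) / 8\<close>, which is at least \<open>log 2 k / 16\<close> once
    \<open>log 2 k\<close> is at least 6.\<close>
  have "1 / 16 * norm (log 2 (real k)) \<le> norm (f k)" if k: "2 ^ 6 \<le> k" for k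
  proof -
    obtain L where L: "2 ^ L \<le> k" "k < 2 ^ (L + 1)"
      using ex_power_ivl1[of 2 k] k by auto
    have "log 2 (real k) < real (L + 1)"
      using L(2) k by (intro log_of_power_less) (simp_all only: flip: of_nat_less_iff[where 'a = real], simp_all)
    moreover have log6: "6 \<le> log 2 (real k)"
      using le_log_of_power[of 2 6 "real k"] k by simp
    ultimately have L6: "log 2 (real k) < real L + 1" "L \<ge> 6" by linarith+
    \<comment> \<open>The quadratic \<open>n * (L + 1) - 2 * n^2\<close> is maximal at
      \<open>(L + 1) / 4\<close>. Rounding down keeps the subtracted term within half of the first
      and loses at most 3 in \<open>4 * n\<close>.\<close>
    define n where "n = (L + 1) div 4"
    have n: "4 * real n \<le> real L + 1" "real L - 2 \<le> 4 * real n"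
      unfolding n_def by linarith+
    have "2 * (real n)\<^sup>2 \<le> real n * ((real L + 1) / 2)"
      unfolding power2_eq_square using mult_left_mono[OF n(1), of "real n"] by simp
    with solves_in_expectation_lower_bound[OF assms L(1), of n] k
    have "(real L + 1) * (real n / 2) \<le> (real L + 1) * max 0 (f k)"
      by (simp add: algebra_simps)
    then have "real n / 2 \<le> max 0 (f k)"
      by (rule mult_left_le_imp_le) simp
    \<comment> \<open>The lower bound on \<open>max 0 (f k)\<close> is positive, so the maximum is
      \<open>f k\<close> itself and equals its norm.\<close>
    with n(2) L6 log6 show ?thesis by (simp split: split_max)
  qed
  then show "eventually (\<lambda>k. norm (f k) \<ge> 1 / 16 * norm (log 2 (real k))) at_top"
    by (rule eventually_mono[OF eventually_ge_at_top[of "2 ^ 6"]])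
qed simp

end
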